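(* Consider the commutative monoids $$H:=\langle a_1,a_2,a_3,b,c_1,c_2,c_3,d\mid a_1b=a_2c_1,\ a_3c_2=c_3d\rangle_{\mathrm{ab}},$$ $$Q:=\langle a,b,c,d\mid ab=ac,\ ac=cd\rangle_{\mathrm{ab}},\qquad J:=\langle a,b,c,d\mid ab=cd\rangle_{\mathrm{ab}},$$ which are objects of $\mathsf{AtoMon}$ whose atoms are precisely their generators. Let $p\colon H\to Q$ be the morphism in $\mathsf{AtoMon}$ given by $p(a_i)=a$, $p(c_i)=c$ for $i\in\{1,2,3\}$, $p(b)=b$, $p(d)=d$, and let $j\colon J\to Q$ be the morphism in $\mathsf{AtoMon}$ sending each generator of $J$ to the generator of $Q$ with the same name. Let $P$, with projections $\sigma\colon P\to H$ and $\rho\colon P\to J$, be the pullback of $p$ and $j$ in $\mathsf{AtoMon}$ (so $p\sigma=j\rho$). Then the pullback morphism $\rho\colon P\to J$ is not a regular epimorphism in $\mathsf{AtoMon}$. Consequently, $\mathsf{AtoMon}$ is not a regular category.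
   Context: Monoids are not assumed to be commutative in general. For a monoid $H$, $H^\times$ denotes its group of units. A non-unit $a\in H$ is an atom if every equality $a=xy$ with $x,y\in H$ implies $x\in H^\times$ or $y\in H^\times$; $\mathcal{A}(H)$ denotes the set of atoms of $H$. The monoid $H$ is atomic if every non-unit of $H$ is a finite non-empty product of atoms. A homomorphism $f\colon H\to K$ between atomic monoids is atom-preserving if $f(\mathcal{A}(H))\subseteq\mathcal{A}(K)$. $\mathsf{AtoMon}$ is the category with objects the atomic monoids and morphisms the atom-preserving monoid homomorphisms; it is complete and cocomplete. $\langle X\mid\mathcal{R}\rangle_{\mathrm{ab}}$ denotes the commutative monoid with set of generators $X$ and defining relations $\mathcal{R}$. A regular epimorphism is a morphism which is the coequalizer of two parallel arrows. A category with finite limits is regular if (1) every morphism $f$ factors as $f=mp$ with $p$ a regular epimorphism and $m$ a monomorphism, and (2) the pullback of a regular epimorphism along any morphism is again a regular epimorphism. *)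

theory Defs
  imports "HOL-Algebra.Group" "HOL-Library.Multiset" "HOL-Library.FuncSet"
    "HOL-Library.Countable_Set"
begin

section \<open>Categories\<close>

text \<open>Composition is written in applicative order: \<open>Comp C g f\<close> is \<open>g\<close> after \<open>f\<close>.
  The values of \<open>Ident\<close> and \<open>Comp\<close> matter only on objects and on composable pairs of arrows.\<close>

record ('o, 'm) cat =
  Ob :: "'o set"
  Arr :: "'m set"
  Dom :: "'m \<Rightarrow> 'o"
  Cod :: "'m \<Rightarrow> 'o"
  Ident :: "'o \<Rightarrow> 'm"
  Comp :: "'m \<Rightarrow> 'm \<Rightarrow> 'm"

definition homs :: "('o, 'm) cat \<Rightarrow> 'o \<Rightarrow> 'o \<Rightarrow> 'm set" where
  "homs C A B = {f \<in> Arr C. Dom C f = A \<and> Cod C f = B}"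

definition category :: "('o, 'm) cat \<Rightarrow> bool" where
  "category C \<longleftrightarrow>
     (\<forall>f\<in>Arr C. Dom C f \<in> Ob C \<and> Cod C f \<in> Ob C) \<and>
     (\<forall>A\<in>Ob C. Ident C A \<in> homs C A A) \<and>
     (\<forall>f\<in>Arr C. Comp C f (Ident C (Dom C f)) = f \<and> Comp C (Ident C (Cod C f)) f = f) \<and>
     (\<forall>f\<in>Arr C. \<forall>g\<in>Arr C. Cod C f = Dom C g \<longrightarrow>
        Comp C g f \<in> homs C (Dom C f) (Cod C g)) \<and>
     (\<forall>f\<in>Arr C. \<forall>g\<in>Arr C. \<forall>h\<in>Arr C. Cod C f = Dom C g \<and> Cod C g = Dom C h \<longrightarrow>
        Comp C h (Comp C g f) = Comp C (Comp C h g) f)"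

definition monomorphism :: "('o, 'm) cat \<Rightarrow> 'm \<Rightarrow> bool" where
  "monomorphism C m \<longleftrightarrow> m \<in> Arr C \<and>
     (\<forall>f\<in>Arr C. \<forall>g\<in>Arr C. Dom C f = Dom C g \<and> Cod C f = Dom C m \<and> Cod C g = Dom C m \<and>
        Comp C m f = Comp C m g \<longrightarrow> f = g)"

definition is_coequalizer :: "('o, 'm) cat \<Rightarrow> 'm \<Rightarrow> 'm \<Rightarrow> 'm \<Rightarrow> bool" where
  "is_coequalizer C f g q \<longleftrightarrow>
     f \<in> Arr C \<and> g \<in> Arr C \<and> Dom C f = Dom C g \<and> Cod C f = Cod C g \<and>
     q \<in> Arr C \<and> Dom C q = Cod C f \<and> Comp C q f = Comp C q g \<and>
     (\<forall>h\<in>Arr C. Dom C h = Cod C f \<and> Comp C h f = Comp C h g \<longrightarrow>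
        (\<exists>!k. k \<in> homs C (Cod C q) (Cod C h) \<and> Comp C k q = h))"

definition regular_epi :: "('o, 'm) cat \<Rightarrow> 'm \<Rightarrow> bool" where
  "regular_epi C q \<longleftrightarrow> (\<exists>f g. is_coequalizer C f g q)"

definition is_pullback :: "('o, 'm) cat \<Rightarrow> 'm \<Rightarrow> 'm \<Rightarrow> 'o \<Rightarrow> 'm \<Rightarrow> 'm \<Rightarrow> bool" where
  "is_pullback C f g P s r \<longleftrightarrow>
     f \<in> Arr C \<and> g \<in> Arr C \<and> Cod C f = Cod C g \<and>
     P \<in> Ob C \<and> s \<in> homs C P (Dom C f) \<and> r \<in> homs C P (Dom C g) \<and>
     Comp C f s = Comp C g r \<and>
     (\<forall>Z\<in>Ob C. \<forall>x\<in>homs C Z (Dom C f). \<forall>y\<in>homs C Z (Dom C g). Comp C f x = Comp C g y \<longrightarrow>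
        (\<exists>!h. h \<in> homs C Z P \<and> Comp C s h = x \<and> Comp C r h = y))"

definition is_functor ::
    "('i, 'k) cat \<Rightarrow> ('o, 'm) cat \<Rightarrow> ('i \<Rightarrow> 'o) \<Rightarrow> ('k \<Rightarrow> 'm) \<Rightarrow> bool" where
  "is_functor I C Fo Fa \<longleftrightarrow>
     (\<forall>i\<in>Ob I. Fo i \<in> Ob C \<and> Fa (Ident I i) = Ident C (Fo i)) \<and>
     (\<forall>u\<in>Arr I. Fa u \<in> homs C (Fo (Dom I u)) (Fo (Cod I u))) \<and>
     (\<forall>u\<in>Arr I. \<forall>v\<in>Arr I. Cod I u = Dom I v \<longrightarrow> Fa (Comp I v u) = Comp C (Fa v) (Fa u))"

definition is_cone ::
    "('i, 'k) cat \<Rightarrow> ('o, 'm) cat \<Rightarrow> ('i \<Rightarrow> 'o) \<Rightarrow> ('k \<Rightarrow> 'm) \<Rightarrow> 'o \<Rightarrow> ('i \<Rightarrow> 'm) \<Rightarrow> bool" where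
  "is_cone I C Fo Fa L l \<longleftrightarrow> L \<in> Ob C \<and> (\<forall>i\<in>Ob I. l i \<in> homs C L (Fo i)) \<and>
     (\<forall>u\<in>Arr I. Comp C (Fa u) (l (Dom I u)) = l (Cod I u))"

definition is_limit ::
    "('i, 'k) cat \<Rightarrow> ('o, 'm) cat \<Rightarrow> ('i \<Rightarrow> 'o) \<Rightarrow> ('k \<Rightarrow> 'm) \<Rightarrow> 'o \<Rightarrow> ('i \<Rightarrow> 'm) \<Rightarrow> bool" where
  "is_limit I C Fo Fa L l \<longleftrightarrow> is_cone I C Fo Fa L l \<and>
     (\<forall>M m. is_cone I C Fo Fa M m \<longrightarrow>
        (\<exists>!h. h \<in> homs C M L \<and> (\<forall>i\<in>Ob I. Comp C (l i) h = m i)))"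

text \<open>Every finite category is isomorphic to one whose objects and arrows are natural numbers.\<close>

definition has_finite_limits :: "('o, 'm) cat \<Rightarrow> bool" where
  "has_finite_limits C \<longleftrightarrow>
     (\<forall>(I :: (nat, nat) cat) Fo Fa.
        category I \<and> finite (Ob I) \<and> finite (Arr I) \<and> is_functor I C Fo Fa \<longrightarrow>
        (\<exists>L l. is_limit I C Fo Fa L l))"

definition regular_category :: "('o, 'm) cat \<Rightarrow> bool" where
  "regular_category C \<longleftrightarrow> category C \<and> has_finite_limits C \<and>
     (\<forall>f\<in>Arr C. \<exists>p m. regular_epi C p \<and> monomorphism C m \<and>
        Cod C p = Dom C m \<and> f = Comp C m p) \<and>
     (\<forall>p g P s r. regular_epi C p \<and> is_pullback C p g P s r \<longrightarrow> regular_epi C r)"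


section \<open>Atomic monoids\<close>

text \<open>The library's \<open>irreducible\<close> is formulated through one-sided divisibility and is
  intended for commutative monoids, so atoms are defined directly.\<close>

definition atoms :: "'u monoid \<Rightarrow> 'u set" where
  "atoms M = {a \<in> carrier M. a \<notin> Units M \<and>
     (\<forall>x\<in>carrier M. \<forall>y\<in>carrier M. a = x \<otimes>\<^bsub>M\<^esub> y \<longrightarrow> x \<in> Units M \<or> y \<in> Units M)}"

definition atomic_monoid :: "'u monoid \<Rightarrow> bool" where
  "atomic_monoid M \<longleftrightarrow> monoid M \<and>
     (\<forall>x \<in> carrier M - Units M.
        \<exists>as. as \<noteq> [] \<and> set as \<subseteq> atoms M \<and> x = foldr (\<otimes>\<^bsub>M\<^esub>) as \<one>\<^bsub>M\<^esub>)"

text \<open>An arrow carries its domain and its codomain; the underlying function is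
  \<open>undefined\<close> outside the carrier of the domain, so that equality of arrows is equality on
  that carrier.  The library's \<open>hom\<close> does not require the unit to be preserved.\<close>

type_synonym 'u arrow = "'u monoid \<times> ('u \<Rightarrow> 'u) \<times> 'u monoid"

definition arrow_fun :: "'u arrow \<Rightarrow> 'u \<Rightarrow> 'u" where
  "arrow_fun f = fst (snd f)"

text \<open>The category of atomic monoids whose elements are taken from the type \<open>'u\<close>, which
  plays the role of the ambient universe of sets.\<close>

definition AtoMon :: "('u monoid, 'u arrow) cat" where
  "AtoMon = \<lparr>
     Ob = {M. atomic_monoid M},
     Arr = {(A, f, B). atomic_monoid A \<and> atomic_monoid B \<and>
              f \<in> hom A B \<and> f \<in> extensional (carrier A) \<and> f \<one>\<^bsub>A\<^esub> = \<one>\<^bsub>B\<^esub> \<and>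
              f ` atoms A \<subseteq> atoms B},
     Dom = (\<lambda>f. fst f),
     Cod = (\<lambda>f. snd (snd f)),
     Ident = (\<lambda>A. (A, restrict id (carrier A), A)),
     Comp = (\<lambda>g f. (fst f, compose (carrier (fst f)) (arrow_fun g) (arrow_fun f), snd (snd g)))\<rparr>"

lemma category_AtoMon: "category (AtoMon :: ('u monoid, 'u arrow) cat)"
proof -
  have idc: "restrict id (carrier A) \<in> hom A A \<and> restrict id (carrier A) \<one>\<^bsub>A\<^esub> = \<one>\<^bsub>A\<^esub>
      \<and> restrict id (carrier A) ` atoms A \<subseteq> atoms A"
    if "atomic_monoid A" for A :: "'u monoid"
  proof -
    have "monoid A" using that by (simp add: atomic_monoid_def)
    moreover have "atoms A \<subseteq> carrier A" by (auto simp only: atoms_def)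
    ultimately show ?thesis
      by (auto simp: hom_def monoid.m_closed monoid.one_closed)
  qed
  have cmp: "compose (carrier A) g f \<in> hom A D \<and> compose (carrier A) g f \<one>\<^bsub>A\<^esub> = \<one>\<^bsub>D\<^esub>
      \<and> compose (carrier A) g f ` atoms A \<subseteq> atoms D"
    if "atomic_monoid A" "f \<in> hom A B" "g \<in> hom B D" "f \<one>\<^bsub>A\<^esub> = \<one>\<^bsub>B\<^esub>" "g \<one>\<^bsub>B\<^esub> = \<one>\<^bsub>D\<^esub>"
      "f ` atoms A \<subseteq> atoms B" "g ` atoms B \<subseteq> atoms D"
    for A B D :: "'u monoid" and f g
  proof (intro conjI)
    have 1: "\<one>\<^bsub>A\<^esub> \<in> carrier A" and 2: "\<And>x y. x \<in> carrier A \<Longrightarrow> y \<in> carrier A \<Longrightarrow> x \<otimes>\<^bsub>A\<^esub> y \<in> carrier A"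
      using that(1) by (auto simp: atomic_monoid_def monoid.m_closed monoid.one_closed)
    show "compose (carrier A) g f \<in> hom A D"
      using that(2,3) 2 by (auto simp: hom_def compose_def Pi_iff)
    show "compose (carrier A) g f \<one>\<^bsub>A\<^esub> = \<one>\<^bsub>D\<^esub>"
      using 1 that(4,5) by (simp add: compose_def)
    have "a \<in> carrier A" if "a \<in> atoms A" for a
      using that by (simp add: atoms_def)
    then show "compose (carrier A) g f ` atoms A \<subseteq> atoms D"
      using that(6,7) by (auto simp: compose_def)
  qed
  have sel: "Ob AtoMon = {M :: 'u monoid. atomic_monoid M}" "\<And>f :: 'u arrow. Dom AtoMon f = fst f"
      "\<And>f :: 'u arrow. Cod AtoMon f = snd (snd f)"
      "\<And>A :: 'u monoid. Ident AtoMon A = (A, restrict id (carrier A), A)"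
      "\<And>(A :: 'u monoid) f B D g E.
        Comp AtoMon (D, g, E) (A, f, B) = (A, compose (carrier A) g f, E)"
    by (simp_all add: AtoMon_def arrow_fun_def)
  have arr: "(A, f, B) \<in> Arr AtoMon \<longleftrightarrow> atomic_monoid A \<and> atomic_monoid B \<and>
              f \<in> hom A B \<and> f \<in> extensional (carrier A) \<and> f \<one>\<^bsub>A\<^esub> = \<one>\<^bsub>B\<^esub> \<and>
              f ` atoms A \<subseteq> atoms B" for A B :: "'u monoid" and f
    by (simp add: AtoMon_def)
  show ?thesis
    unfolding category_def
  proof (intro conjI ballI impI)
    fix f :: "'u arrow" assume f0: "f \<in> Arr AtoMon"
    obtain A f' B where F: "f = (A, f', B)" by (cases f)
    note f = f0[unfolded F arr]
    show "Dom AtoMon f \<in> Ob AtoMon" "Cod AtoMon f \<in> Ob AtoMon"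
      using f by (simp_all add: F sel)
    have f': "f' x \<in> carrier B" if "x \<in> carrier A" for x
      using f that by (auto simp: hom_def)
    show "Comp AtoMon f (Ident AtoMon (Dom AtoMon f)) = f"
      using f by (auto simp: F sel compose_def fun_eq_iff extensional_def)
    show "Comp AtoMon (Ident AtoMon (Cod AtoMon f)) f = f"
      using f f' by (auto simp: F sel compose_def fun_eq_iff extensional_def)
    fix g :: "'u arrow" assume g0: "g \<in> Arr AtoMon"
    obtain C g' D where G: "g = (C, g', D)" by (cases g)
    note g = g0[unfolded G arr]
    {
      assume "Cod AtoMon f = Dom AtoMon g"
      then have "C = B" by (simp add: F G sel)
      then show "Comp AtoMon g f \<in> homs AtoMon (Dom AtoMon f) (Cod AtoMon g)"
        using f g cmp[of A f' B g' D] by (simp add: F G sel homs_def arr)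
    }
    fix h :: "'u arrow" assume "h \<in> Arr AtoMon"
    obtain E h' K where K: "h = (E, h', K)" by (cases h)
    assume "Cod AtoMon f = Dom AtoMon g \<and> Cod AtoMon g = Dom AtoMon h"
    then have "C = B" "E = D" by (simp_all add: F G K sel)
    then show "Comp AtoMon h (Comp AtoMon g f) = Comp AtoMon (Comp AtoMon h g) f"
      using f' by (auto simp: F G K sel compose_def fun_eq_iff)
  next
    fix A :: "'u monoid" assume "A \<in> Ob AtoMon"
    then show "Ident AtoMon A \<in> homs AtoMon A A"
      using idc[of A] by (simp add: homs_def arr sel)
  qed
qed


section \<open>Commutative monoids given by generators and relations\<close>

text \<open>The generators are all elements of the type \<open>'x\<close>; words in commuting generators are
  multisets.\<close>

inductive comm_cong :: "('x multiset \<times> 'x multiset) set \<Rightarrow> 'x multiset \<Rightarrow> 'x multiset \<Rightarrow> bool"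
  for R where
  rel: "(u, v) \<in> R \<Longrightarrow> comm_cong R u v"
| refl: "comm_cong R u u"
| sym: "comm_cong R u v \<Longrightarrow> comm_cong R v u"
| trans: "comm_cong R u v \<Longrightarrow> comm_cong R v w \<Longrightarrow> comm_cong R u w"
| add: "comm_cong R u v \<Longrightarrow> comm_cong R (u + w) (v + w)"

definition comm_class :: "('x multiset \<times> 'x multiset) set \<Rightarrow> 'x multiset \<Rightarrow> 'x multiset set" where
  "comm_class R u = {v. comm_cong R u v}"

definition comm_pres :: "('x multiset \<times> 'x multiset) set \<Rightarrow> 'x multiset set monoid" where
  "comm_pres R = \<lparr>
     carrier = range (comm_class R),
     monoid.mult = (\<lambda>S T. {w. \<exists>u\<in>S. \<exists>v\<in>T. comm_cong R (u + v) w}),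
     monoid.one = comm_class R {#}\<rparr>"

text \<open>\<open>M\<close> is (a copy of) the commutative monoid presented by the relations \<open>R\<close>, the generator
  \<open>x\<close> being the element \<open>gen x\<close> of \<open>M\<close>.\<close>

definition presented_by ::
    "'u monoid \<Rightarrow> ('x multiset \<times> 'x multiset) set \<Rightarrow> ('x \<Rightarrow> 'u) \<Rightarrow> bool" where
  "presented_by M R gen \<longleftrightarrow> comm_monoid M \<and>
     (\<exists>\<phi> \<in> iso (comm_pres R) M. \<forall>x. gen x = \<phi> (comm_class R {#x#}))"

lemma comm_class_eq_iff: "comm_class R u = comm_class R v \<longleftrightarrow> comm_cong R u v"
  unfolding comm_class_def by (auto intro: comm_cong.intros)

lemma mult_comm_class:
  "comm_class R u \<otimes>\<^bsub>comm_pres R\<^esub> comm_class R v = comm_class R (u + v)"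
proof -
  have add2: "comm_cong R (u + v) (u' + v')" if "comm_cong R u u'" "comm_cong R v v'" for u' v'
    by (metis that comm_cong.trans comm_cong.add add.commute)
  show ?thesis
    unfolding comm_pres_def comm_class_def
    using add2 by (auto intro: comm_cong.intros)
qed

lemma comm_monoid_comm_pres: "comm_monoid (comm_pres R)"
proof -
  have c: "carrier (comm_pres R) = range (comm_class R)" and o: "\<one>\<^bsub>comm_pres R\<^esub> = comm_class R {#}"
    by (simp_all add: comm_pres_def)
  show ?thesis
    by (rule comm_monoidI) (auto simp: c o mult_comm_class add_ac)
qed

text \<open>A universe with infinitely many elements contains a copy of every commutative monoid
  with countably many generators.\<close>

lemma ex_presented_by:
  fixes R :: "('x::countable multiset \<times> 'x multiset) set"
  assumes "infinite (UNIV :: 'u set)"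
  shows "\<exists>(M :: 'u monoid) gen. presented_by M R gen"
proof -
  let ?G = "comm_pres R"
  interpret G: comm_monoid ?G by (rule comm_monoid_comm_pres)
  have "carrier ?G = range (\<lambda>xs. comm_class R (mset xs))"
    by (auto simp: comm_pres_def) (metis ex_mset rangeI)
  then have "countable (carrier ?G)" by simp
  then obtain t :: "'x multiset set \<Rightarrow> nat" where t: "inj_on t (carrier ?G)"
    by (auto simp: countable_def)
  obtain i :: "nat \<Rightarrow> 'u" where i: "inj i"
    using infinite_countable_subset[OF assms] by auto
  define e where "e = i \<circ> t"
  define d where "d = inv_into (carrier ?G) e"
  have e: "inj_on e (carrier ?G)"
    unfolding e_def using t i by (meson comp_inj_on inj_on_subset subset_UNIV)
  have de: "d (e x) = x" if "x \<in> carrier ?G" for x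
    using that e by (simp add: d_def)
  define M where "M = \<lparr>carrier = e ` carrier ?G,
      monoid.mult = (\<lambda>x y. e (d x \<otimes>\<^bsub>?G\<^esub> d y)), monoid.one = e \<one>\<^bsub>?G\<^esub>\<rparr>"
  have "comm_monoid M"
    by (rule comm_monoidI) (auto simp: M_def de G.m_ac)
  moreover have "e \<in> iso ?G M"
    using e by (auto simp: iso_def hom_def bij_betw_def M_def de)
  ultimately have "presented_by M R (\<lambda>x. e (comm_class R {#x#}))"
    unfolding presented_by_def by auto
  then show ?thesis by blast
qed


section \<open>The monoids in question\<close>

datatype gen_H = Ha1 | Ha2 | Ha3 | Hb | Hc1 | Hc2 | Hc3 | Hd

datatype gen = Ga | Gb | Gc | Gd

definition rels_H :: "(gen_H multiset \<times> gen_H multiset) set" where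
  "rels_H = {({#Ha1, Hb#}, {#Ha2, Hc1#}), ({#Ha3, Hc2#}, {#Hc3, Hd#})}"

definition rels_Q :: "(gen multiset \<times> gen multiset) set" where
  "rels_Q = {({#Ga, Gb#}, {#Ga, Gc#}), ({#Ga, Gc#}, {#Gc, Gd#})}"

definition rels_J :: "(gen multiset \<times> gen multiset) set" where
  "rels_J = {({#Ga, Gb#}, {#Gc, Gd#})}"

fun letter :: "gen_H \<Rightarrow> gen" where
  "letter Ha1 = Ga" | "letter Ha2 = Ga" | "letter Ha3 = Ga"
| "letter Hb = Gb"
| "letter Hc1 = Gc" | "letter Hc2 = Gc" | "letter Hc3 = Gc"
| "letter Hd = Gd"

end

theory Submission
  imports Defs
begin

text \<open>
  Parallel arrows into the pullback \<open>P\<close> send atoms to atoms, so their coequalizer is the quotient of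
  \<open>P\<close> by identifications between atoms and the consequences of these.  Concretely, \<open>P\<close> is the
  submonoid of \<open>H \<times> J\<close> generated by the pairs \<open>(x, letter x)\<close>.  The defining relations of \<open>H\<close>
  do not lift to \<open>P\<close>, since in \<open>J\<close> the product \<open>ac\<close> differs from \<open>ab\<close> and \<open>cd\<close>; nontrivial
  relations of \<open>P\<close> have degree at least 3 (the basic one is \<open>a\<^sub>1ba\<^sub>3c\<^sub>2 = a\<^sub>2c\<^sub>1c\<^sub>3d\<close>).
  Hence the letter map is an arrow from \<open>P\<close> to the commutative monoid on \<open>a,b,c,d\<close> in which any two
  words of the same length at least 3 are identified.  It coequalizes every pair of arrows
  coequalized by \<open>\<rho>\<close>, but does not factor through \<open>\<rho>\<close>, as \<open>ab = cd\<close> holds in \<open>J\<close>.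
  On the other hand \<open>p\<close> is a regular epimorphism, since \<open>Q\<close> is obtained from \<open>H\<close> by
  identifying the \<open>a\<^sub>i\<close> and the \<open>c\<^sub>i\<close>.
\<close>

section \<open>Arrows between atomic monoids\<close>

lemma AtoMon_sel:
  "Ob AtoMon = {M :: 'u monoid. atomic_monoid M}"
  "Dom AtoMon (f :: 'u arrow) = fst f"
  "Cod AtoMon (f :: 'u arrow) = snd (snd f)"
  by (simp_all add: AtoMon_def)

lemma homs_AtoMon_iff:
  "k \<in> homs AtoMon A B \<longleftrightarrow> (\<exists>f. k = (A, f, B) \<and> atomic_monoid A \<and> atomic_monoid B \<and>
     f \<in> hom A B \<and> f \<in> extensional (carrier A) \<and> f \<one>\<^bsub>A\<^esub> = \<one>\<^bsub>B\<^esub> \<and> f ` atoms A \<subseteq> atoms B)"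
  by (auto simp: homs_def AtoMon_def)

lemma Arr_AtoMon_homs: "k \<in> Arr AtoMon \<Longrightarrow> k \<in> homs AtoMon (fst k) (snd (snd k))"
  by (simp add: homs_def AtoMon_sel)

lemma homs_AtoMonD:
  assumes "k \<in> homs AtoMon A B"
  shows "k \<in> Arr AtoMon" "fst k = A" "snd (snd k) = B" "atomic_monoid A" "atomic_monoid B"
    "arrow_fun k \<one>\<^bsub>A\<^esub> = \<one>\<^bsub>B\<^esub>"
  using assms by (auto simp: homs_def AtoMon_def arrow_fun_def)

lemma arrow_mult:
  "k \<in> homs AtoMon A B \<Longrightarrow> x \<in> carrier A \<Longrightarrow> y \<in> carrier A \<Longrightarrow>
    arrow_fun k (x \<otimes>\<^bsub>A\<^esub> y) = arrow_fun k x \<otimes>\<^bsub>B\<^esub> arrow_fun k y"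
  by (auto simp: homs_AtoMon_iff arrow_fun_def hom_def)

lemma arrow_closed: "k \<in> homs AtoMon A B \<Longrightarrow> x \<in> carrier A \<Longrightarrow> arrow_fun k x \<in> carrier B"
  by (auto simp: homs_AtoMon_iff arrow_fun_def hom_def)

lemma arrow_atom: "k \<in> homs AtoMon A B \<Longrightarrow> x \<in> atoms A \<Longrightarrow> arrow_fun k x \<in> atoms B"
  by (auto simp: homs_AtoMon_iff arrow_fun_def)

lemma arrow_unit:
  assumes "k \<in> homs AtoMon A B" "x \<in> Units A"
  shows "arrow_fun k x \<in> Units B"
proof -
  from assms(2) obtain y where "x \<in> carrier A" "y \<in> carrier A" "x \<otimes>\<^bsub>A\<^esub> y = \<one>\<^bsub>A\<^esub>" "y \<otimes>\<^bsub>A\<^esub> x = \<one>\<^bsub>A\<^esub>"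
    by (auto simp: Units_def)
  then show ?thesis
    using arrow_mult[OF assms(1)] arrow_closed[OF assms(1)] homs_AtoMonD(6)[OF assms(1)]
    unfolding Units_def by (metis (mono_tags, lifting) mem_Collect_eq)
qed

lemma arrow_eqI:
  assumes "k \<in> homs AtoMon A B" "l \<in> homs AtoMon A B"
    and "\<And>x. x \<in> carrier A \<Longrightarrow> arrow_fun k x = arrow_fun l x"
  shows "k = l"
  using assms by (auto simp: homs_AtoMon_iff arrow_fun_def intro: extensionalityI)

lemma arrow_exI:
  assumes "atomic_monoid A" "atomic_monoid B"
    and "\<And>x. x \<in> carrier A \<Longrightarrow> f x \<in> carrier B"
    and "\<And>x y. x \<in> carrier A \<Longrightarrow> y \<in> carrier A \<Longrightarrow> f (x \<otimes>\<^bsub>A\<^esub> y) = f x \<otimes>\<^bsub>B\<^esub> f y"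
    and "f \<one>\<^bsub>A\<^esub> = \<one>\<^bsub>B\<^esub>" and "\<And>x. x \<in> atoms A \<Longrightarrow> f x \<in> atoms B"
  obtains k where "k \<in> homs AtoMon A B" "\<And>x. x \<in> carrier A \<Longrightarrow> arrow_fun k x = f x"
proof
  have "monoid A" using assms(1) by (simp add: atomic_monoid_def)
  moreover have "a \<in> carrier A" if "a \<in> atoms A" for a using that by (simp add: atoms_def)
  ultimately show "(A, restrict f (carrier A), B) \<in> homs AtoMon A B"
    using assms by (auto simp: homs_AtoMon_iff hom_def monoid.m_closed monoid.one_closed)
qed (simp add: arrow_fun_def)

lemma Comp_homs:
  assumes "k \<in> homs AtoMon A B" "l \<in> homs AtoMon B C"
  shows "Comp AtoMon l k \<in> homs AtoMon A C"
  using assms category_AtoMon unfolding category_def homs_def by auto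

lemma arrow_Comp:
  "k \<in> homs AtoMon A B \<Longrightarrow> x \<in> carrier A \<Longrightarrow>
    arrow_fun (Comp AtoMon l k) x = arrow_fun l (arrow_fun k x)"
  by (drule homs_AtoMonD(2)) (simp add: AtoMon_def arrow_fun_def compose_def)

lemma Comp_eq_arrow_iff:
  assumes k: "k \<in> homs AtoMon A B" and l: "l \<in> homs AtoMon B C" and h: "h \<in> homs AtoMon A C"
  shows "Comp AtoMon l k = h \<longleftrightarrow> (\<forall>x\<in>carrier A. arrow_fun l (arrow_fun k x) = arrow_fun h x)"
proof
  assume "Comp AtoMon l k = h"
  then show "\<forall>x\<in>carrier A. arrow_fun l (arrow_fun k x) = arrow_fun h x"
    using arrow_Comp[OF k, of _ l] by simp
next
  assume "\<forall>x\<in>carrier A. arrow_fun l (arrow_fun k x) = arrow_fun h x"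
  then show "Comp AtoMon l k = h"
    by (intro arrow_eqI[OF Comp_homs[OF k l] h]) (simp add: arrow_Comp[OF k])
qed

lemma Comp_eq_iff:
  assumes "k \<in> homs AtoMon A B" "l \<in> homs AtoMon B C" "k' \<in> homs AtoMon A B'" "l' \<in> homs AtoMon B' C"
  shows "Comp AtoMon l k = Comp AtoMon l' k' \<longleftrightarrow>
    (\<forall>x\<in>carrier A. arrow_fun l (arrow_fun k x) = arrow_fun l' (arrow_fun k' x))"
  by (simp add: Comp_eq_arrow_iff[OF assms(1,2) Comp_homs[OF assms(3,4)]] arrow_Comp[OF assms(3)])

text \<open>A non-unit is a \<open>foldr\<close> product of atoms, so a property closed under
  multiplication has to be checked on units and atoms only.\<close>

lemma atomic_monoid_induct [consumes 2, case_names unit atom mult]: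
  assumes A: "atomic_monoid A" and z: "z \<in> carrier A"
    and unit: "\<And>x. x \<in> Units A \<Longrightarrow> S x"
    and atom: "\<And>x. x \<in> atoms A \<Longrightarrow> S x"
    and mult: "\<And>x y. x \<in> carrier A \<Longrightarrow> y \<in> carrier A \<Longrightarrow> S x \<Longrightarrow> S y \<Longrightarrow> S (x \<otimes>\<^bsub>A\<^esub> y)"
  shows "S z"
proof (cases "z \<in> Units A")
  case False
  interpret monoid A using A by (simp add: atomic_monoid_def)
  have ac: "a \<in> carrier A" if "a \<in> atoms A" for a using that by (simp add: atoms_def)
  obtain as where as: "set as \<subseteq> atoms A" "z = foldr (\<otimes>\<^bsub>A\<^esub>) as \<one>\<^bsub>A\<^esub>"
    using A z False by (auto simp: atomic_monoid_def)
  \<comment> \<open>Carrier membership is carried along because \<open>mult\<close> asks for it; the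
    empty product is the unit element, covered by \<open>unit\<close>.\<close>
  have "foldr (\<otimes>\<^bsub>A\<^esub>) as \<one>\<^bsub>A\<^esub> \<in> carrier A \<and> S (foldr (\<otimes>\<^bsub>A\<^esub>) as \<one>\<^bsub>A\<^esub>)"
    using as(1) by (induction as) (auto intro: ac unit atom mult)
  with as(2) show ?thesis by simp
qed (rule unit)

text \<open>Units are sent to units, so a trivial unit group in \<open>B\<close> forces agreement on
  all units of \<open>A\<close>; atoms and products are left to the induction.\<close>

lemma arrow_eq_on_atomsI:
  assumes k: "k \<in> homs AtoMon A B" and l: "l \<in> homs AtoMon A B" and U: "Units B = {\<one>\<^bsub>B\<^esub>}"
    and at: "\<And>x. x \<in> atoms A \<Longrightarrow> arrow_fun k x = arrow_fun l x"
  shows "k = l"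
proof (rule arrow_eqI[OF k l])
  fix x assume "x \<in> carrier A"
  with homs_AtoMonD(4)[OF k] show "arrow_fun k x = arrow_fun l x"
  proof (induction rule: atomic_monoid_induct)
    case (unit x)
    then show ?case using arrow_unit[OF k] arrow_unit[OF l] U by auto
  next
    case (mult x y)
    then show ?case by (simp add: arrow_mult[OF k] arrow_mult[OF l])
  qed (rule at)
qed


section \<open>Homogeneous presentations\<close>

text \<open>\<open>ev\<close> evaluates words. Its kernel is the congruence, so later arguments
  compare words instead of congruence classes.\<close>

locale presentation =
  fixes M :: "'u monoid" and R :: "('x multiset \<times> 'x multiset) set"
    and gen :: "'x \<Rightarrow> 'u" and ev :: "'x multiset \<Rightarrow> 'u"
  assumes comm_monoid: "comm_monoid M"
    and range_ev: "range ev = carrier M"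
    and ev_add: "ev (u + v) = ev u \<otimes>\<^bsub>M\<^esub> ev v"
    and ev_empty: "ev {#} = \<one>\<^bsub>M\<^esub>"
    and ev_single: "ev {#x#} = gen x"
    and ev_eq_iff: "ev u = ev v \<longleftrightarrow> comm_cong R u v"

lemma presented_by_presentation:
  assumes "presented_by M R gen"
  obtains ev where "presentation M R gen ev"
proof -
  interpret M: comm_monoid M using assms by (simp add: presented_by_def)
  obtain \<phi> where \<phi>: "\<phi> \<in> iso (comm_pres R) M" and g: "\<And>x. gen x = \<phi> (comm_class R {#x#})"
    using assms by (auto simp: presented_by_def)
  have car: "carrier (comm_pres R) = range (comm_class R)" by (simp add: comm_pres_def)
  have bij: "bij_betw \<phi> (range (comm_class R)) (carrier M)"
    using \<phi> by (simp add: iso_def car)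
  have hom: "\<phi> (comm_class R (u + v)) = \<phi> (comm_class R u) \<otimes>\<^bsub>M\<^esub> \<phi> (comm_class R v)" for u v
    using \<phi> by (auto simp: iso_def hom_def car simp flip: mult_comm_class)
  have im: "range (\<lambda>u. \<phi> (comm_class R u)) = carrier M"
    using bij_betw_imp_surj_on[OF bij] by (simp add: image_image)
  \<comment> \<open>Membership in \<open>iso\<close> supplies multiplicativity only; by surjectivity
    the image of the class of the empty word is neutral, hence the unit.\<close>
  have "\<phi> (comm_class R {#}) \<otimes>\<^bsub>M\<^esub> x = x" if x: "x \<in> carrier M" for x
  proof -
    obtain u where "x = \<phi> (comm_class R u)" using x im by auto
    then show ?thesis using hom[of "{#}" u] by simp
  qed
  then have "\<phi> (comm_class R {#}) = \<one>\<^bsub>M\<^esub>"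
    using im by (metis M.one_closed M.r_one rangeI)
  moreover have "\<phi> (comm_class R u) = \<phi> (comm_class R v) \<longleftrightarrow> comm_cong R u v" for u v
    using inj_on_eq_iff[OF bij_betw_imp_inj_on[OF bij] rangeI rangeI]
    by (simp only: comm_class_eq_iff)
  ultimately have "presentation M R gen (\<lambda>u. \<phi> (comm_class R u))"
    by unfold_locales (use im in \<open>auto simp: hom g\<close>)
  then show thesis by (rule that)
qed

context presentation
begin

lemma ev_closed: "ev u \<in> carrier M"
  using range_ev by blast

lemma carrierE:
  assumes "x \<in> carrier M"
  obtains u where "x = ev u"
  using assms range_ev by blast

lemma ev_rel: "(u, v) \<in> R \<Longrightarrow> ev u = ev v"
  by (simp add: ev_eq_iff comm_cong.rel)

end

text \<open>Length becomes an invariant and generators stay distinct. The alternative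
  \<open>u = v\<close> admits \<open>rels_P\<close>, which contains every reflexive pair, also those
  of length below 2.\<close>

locale homogeneous = presentation +
  assumes size_R: "(u, v) \<in> R \<Longrightarrow> size u = size v \<and> (u = v \<or> 2 \<le> size u)"
begin

lemma comm_cong_size: "comm_cong R u v \<Longrightarrow> size u = size v"
  by (induction rule: comm_cong.induct) (auto dest: size_R)

lemma comm_cong_short:
  assumes "comm_cong R u v" "size u < 2"
  shows "u = v"
  using assms
proof (induction rule: comm_cong.induct)
  case (sym u v)
  then show ?case using comm_cong_size by metis
next
  case (trans u v w)
  then show ?case using comm_cong_size by metis
qed (auto dest: size_R)

text \<open>In degree 2 the congruence is the equivalence relation generated by the relations.\<close>

lemma comm_cong_size_2:
  assumes "comm_cong R u v" "size u = 2" and n: "\<And>u v. (u, v) \<in> R \<Longrightarrow> n u = n v"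
  shows "n u = n v"
  using assms(1,2)
proof (induction rule: comm_cong.induct)
  case (sym u v)
  then show ?case using comm_cong_size by metis
next
  case (trans u v w)
  then show ?case using comm_cong_size by metis
next
  case (add u v w)
  \<comment> \<open>A nonempty \<open>w\<close> leaves \<open>u\<close> with length below 2, where
    congruent words are equal.\<close>
  show ?case
  proof (cases "w = {#}")
    case False
    then have "0 < size w" by (simp add: nonempty_has_size)
    with add.prems have "size u < 2" using size_union[of u w] by linarith
    with add comm_cong_short show ?thesis by blast
  qed (use add in simp)
qed (auto intro: n)

section \<open>Units and atoms of homogeneously presented monoids\<close>

lemma ev_eq_oneD: "ev u = \<one>\<^bsub>M\<^esub> \<Longrightarrow> u = {#}"
  using comm_cong_size[of u "{#}"] by (simp add: ev_eq_iff flip: ev_empty)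

lemma ev_eq_genD: "ev u = gen x \<Longrightarrow> u = {#x#}"
  using comm_cong_size[of u "{#x#}"] comm_cong_short[of u "{#x#}"]
  by (simp add: ev_eq_iff flip: ev_single)

lemma inj_gen: "inj gen"
proof (rule injI)
  fix x y assume "gen x = gen y"
  then have "{#x#} = {#y#}" by (intro ev_eq_genD) (simp add: ev_single)
  then show "x = y" by simp
qed

lemma Units_eq: "Units M = {\<one>\<^bsub>M\<^esub>}"
proof -
  interpret comm_monoid M by (rule comm_monoid)
  have "x = \<one>\<^bsub>M\<^esub>" if x: "x \<in> Units M" for x
  proof -
    obtain y where xy: "x \<in> carrier M" "y \<in> carrier M" "x \<otimes>\<^bsub>M\<^esub> y = \<one>\<^bsub>M\<^esub>"
      using x unfolding Units_def by blast
    obtain u where u: "x = ev u" using xy(1) by (rule carrierE)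
    obtain v where v: "y = ev v" using xy(2) by (rule carrierE)
    have "u + v = {#}" using xy(3) by (intro ev_eq_oneD) (simp add: u v ev_add)
    then show ?thesis by (simp add: u ev_empty)
  qed
  then show ?thesis by auto
qed

lemma ev_Units_iff: "ev u \<in> Units M \<longleftrightarrow> u = {#}"
  using ev_eq_oneD by (auto simp: Units_eq ev_empty)

text \<open>An atom has a nonempty word; once a letter is split off, the rest must be a unit, hence
  empty. Conversely a generator is represented by its one-letter word only, which splits only
  trivially.\<close>

lemma atoms_eq: "atoms M = range gen"
proof (intro equalityI subsetI)
  fix a assume a: "a \<in> atoms M"
  then have "a \<in> carrier M" by (simp add: atoms_def)
  then obtain u where u: "a = ev u" by (rule carrierE)
  from a have "u \<noteq> {#}" by (auto simp: u atoms_def ev_Units_iff)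
  then obtain x v where xv: "u = {#x#} + v" by (metis multiset_cases add_mset_add_single add.commute)
  have "ev {#x#} \<in> Units M \<or> ev v \<in> Units M"
    using a ev_closed by (auto simp: atoms_def u xv ev_add simp del: union_mset_add_mset_left)
  then have "v = {#}" by (simp only: ev_Units_iff) simp
  then show "a \<in> range gen" by (simp add: u xv ev_single)
next
  fix a assume "a \<in> range gen"
  then obtain x where x: "a = gen x" by auto
  have a: "a = ev {#x#}" by (simp add: x ev_single)
  have "y \<in> Units M \<or> z \<in> Units M"
    if yz: "y \<in> carrier M" "z \<in> carrier M" "a = y \<otimes>\<^bsub>M\<^esub> z" for y z
  proof -
    obtain u where u: "y = ev u" using yz(1) by (rule carrierE)
    obtain v where v: "z = ev v" using yz(2) by (rule carrierE)
    have "u + v = {#x#}" using yz(3) by (intro ev_eq_genD) (simp add: u v x ev_add)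
    then have "u = {#} \<or> v = {#}" by (auto simp: union_is_single)
    then show ?thesis by (simp add: u v ev_Units_iff)
  qed
  then show "a \<in> atoms M" by (auto simp: atoms_def a ev_closed ev_Units_iff)
qed

lemma bij_betw_gen: "bij_betw gen UNIV (atoms M)"
  by (simp add: bij_betw_def inj_gen atoms_eq)

lemma atomic_monoid: "atomic_monoid M"
proof -
  interpret comm_monoid M by (rule comm_monoid)
  have "\<exists>as. as \<noteq> [] \<and> set as \<subseteq> atoms M \<and> x = foldr (\<otimes>\<^bsub>M\<^esub>) as \<one>\<^bsub>M\<^esub>"
    if x: "x \<in> carrier M - Units M" for x
  proof -
    obtain u where u: "x = ev u" using x carrierE by blast
    obtain xs where xs: "u = mset xs" by (metis ex_mset)
    have "ev (mset xs) = foldr (\<otimes>\<^bsub>M\<^esub>) (map gen xs) \<one>\<^bsub>M\<^esub>"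
    proof (induction xs)
      case (Cons a xs)
      then show ?case using ev_add[of "{#a#}" "mset xs"] by (simp add: ev_single)
    qed (simp add: ev_empty)
    moreover have "xs \<noteq> []" using x by (auto simp: u xs ev_Units_iff)
    ultimately show ?thesis
      by (intro exI[of _ "map gen xs"]) (auto simp: atoms_eq u xs)
  qed
  then show ?thesis by (simp add: atomic_monoid_def comm_monoid.axioms(1)[OF comm_monoid])
qed

text \<open>The universal property; \<open>K\<close> need not be commutative.\<close>

lemma universal_arrow:
  assumes K: "atomic_monoid K"
    and \<psi>: "\<And>u. \<psi> u \<in> carrier K" "\<psi> {#} = \<one>\<^bsub>K\<^esub>" "\<And>u v. \<psi> (u + v) = \<psi> u \<otimes>\<^bsub>K\<^esub> \<psi> v"
    and at: "\<And>x. \<psi> {#x#} \<in> atoms K" and rel: "\<And>u v. (u, v) \<in> R \<Longrightarrow> \<psi> u = \<psi> v"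
  obtains k where "k \<in> homs AtoMon M K" "\<And>u. arrow_fun k (ev u) = \<psi> u"
proof -
  have cong: "\<psi> u = \<psi> v" if "comm_cong R u v" for u v
    using that by (induction rule: comm_cong.induct) (auto simp: rel \<psi>(3))
  define f where "f x = \<psi> (SOME u. ev u = x)" for x
  have f: "f (ev u) = \<psi> u" for u
    unfolding f_def by (rule cong) (use someI[of "\<lambda>v. ev v = ev u" u] in \<open>simp add: ev_eq_iff\<close>)
  obtain k where "k \<in> homs AtoMon M K" "\<And>x. x \<in> carrier M \<Longrightarrow> arrow_fun k x = f x"
  proof (rule arrow_exI[OF atomic_monoid K, where f = f])
    show "f x \<in> carrier K" if "x \<in> carrier M" for x
      using that by (metis carrierE f \<psi>(1))
    show "f (x \<otimes>\<^bsub>M\<^esub> y) = f x \<otimes>\<^bsub>K\<^esub> f y" if "x \<in> carrier M" "y \<in> carrier M" for x y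
      using that by (metis carrierE f \<psi>(3) ev_add)
    show "f \<one>\<^bsub>M\<^esub> = \<one>\<^bsub>K\<^esub>" by (metis f \<psi>(2) ev_empty)
    show "f x \<in> atoms K" if "x \<in> atoms M" for x
      using that at by (auto simp: atoms_eq f simp flip: ev_single)
  qed blast
  then show thesis using that f ev_closed by metis
qed

end

section \<open>Arrows given by maps of generators\<close>

locale two_homogeneous = A: homogeneous A R gen ev + B: homogeneous B S gen' ev'
  for A :: "'u monoid" and R :: "('x multiset \<times> 'x multiset) set" and gen ev
    and B :: "'u monoid" and S :: "('y multiset \<times> 'y multiset) set" and gen' ev'
begin

lemma arrow_on_ev:
  assumes k: "k \<in> homs AtoMon A B" and t: "\<And>x. arrow_fun k (gen x) = gen' (t x)"
  shows "arrow_fun k (ev u) = ev' (image_mset t u)"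
proof (induction u)
  case empty
  show ?case using homs_AtoMonD(6)[OF k] by (simp add: A.ev_empty B.ev_empty)
next
  case (add x u)
  then show ?case
    using arrow_mult[OF k A.ev_closed A.ev_closed, of "{#x#}" u] t[of x]
      A.ev_add[of "{#x#}" u] B.ev_add[of "{#t x#}" "image_mset t u"]
    by (simp add: A.ev_single B.ev_single)
qed

text \<open>Relabelling letters and then evaluating in \<open>B\<close> gives a map to which the
  universal property of \<open>A\<close> applies. Uniqueness holds because the generators are all
  the atoms of \<open>A\<close> and \<open>B\<close> has trivial units.\<close>

lemma ex1_arrow:
  assumes "\<And>u v. (u, v) \<in> R \<Longrightarrow> ev' (image_mset t u) = ev' (image_mset t v)"
  shows "\<exists>!k. k \<in> homs AtoMon A B \<and> (\<forall>x. arrow_fun k (gen x) = gen' (t x))"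
proof (rule ex_ex1I)
  obtain k where "k \<in> homs AtoMon A B" "\<And>u. arrow_fun k (ev u) = ev' (image_mset t u)"
    by (rule A.universal_arrow[OF B.atomic_monoid, of "\<lambda>u. ev' (image_mset t u)"])
      (use assms in \<open>auto simp: B.ev_closed B.ev_empty B.ev_add B.ev_single B.atoms_eq\<close>)
  then show "\<exists>k. k \<in> homs AtoMon A B \<and> (\<forall>x. arrow_fun k (gen x) = gen' (t x))"
    by (metis A.ev_single B.ev_single image_mset_single)
next
  fix k l
  assume "k \<in> homs AtoMon A B \<and> (\<forall>x. arrow_fun k (gen x) = gen' (t x))"
    "l \<in> homs AtoMon A B \<and> (\<forall>x. arrow_fun l (gen x) = gen' (t x))"
  then show "k = l"
    by (intro arrow_eq_on_atomsI[of k A B l]) (auto simp: A.atoms_eq B.Units_eq)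
qed

end

text \<open>Auxiliary objects must live in the same category, so over \<open>'u\<close>; an infinite
  universe has room for countably many generators. This provides the free monoid \<open>F\<close>,
  the pullback \<open>P\<close> and the test monoid \<open>K\<close>.\<close>

lemma ex_homogeneous:
  fixes R :: "('x::countable multiset \<times> 'x multiset) set"
  assumes "infinite (UNIV :: 'u set)" "\<And>u v. (u, v) \<in> R \<Longrightarrow> size u = size v \<and> (u = v \<or> 2 \<le> size u)"
  obtains M :: "'u monoid" and gen ev where "homogeneous M R gen ev"
proof -
  obtain M :: "'u monoid" and gen where "presented_by M R gen"
    using ex_presented_by[OF assms(1)] by blast
  then obtain ev where "presentation M R gen ev" by (rule presented_by_presentation)
  then have "homogeneous M R gen ev"
    by (intro homogeneous.intro homogeneous_axioms.intro) (auto dest: assms(2))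
  then show thesis by (rule that)
qed

instance gen :: countable by countable_datatype

instance gen_H :: countable by countable_datatype


section \<open>The monoids H, Q and J\<close>

locale HQJ = H: homogeneous H rels_H genH evH + Q: homogeneous Q rels_Q genQ evQ +
    J: homogeneous J rels_J genJ evJ
  for H Q J :: "'u monoid" and genH evH genQ evQ genJ evJ +
  fixes p j
  assumes p: "p \<in> homs AtoMon H Q" "\<And>x. arrow_fun p (genH x) = genQ (letter x)"
    and j: "j \<in> homs AtoMon J Q" "\<And>x. arrow_fun j (genJ x) = genQ x"
    and infinite_univ: "infinite (UNIV :: 'u set)"
begin

sublocale HQ: two_homogeneous H rels_H genH evH Q rels_Q genQ evQ ..

sublocale JQ: two_homogeneous J rels_J genJ evJ Q rels_Q genQ evQ ..

lemma p_ev: "arrow_fun p (evH u) = evQ (image_mset letter u)"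
  by (rule HQ.arrow_on_ev) (use p in auto)

lemma j_ev: "arrow_fun j (evJ u) = evQ u"
  using JQ.arrow_on_ev[of j "\<lambda>x. x"] j by simp

end

text \<open>Stability under pullback speaks of regular epimorphisms only, so \<open>p\<close> has to
  be one. It is the coequalizer of two arrows from a free commutative monoid, each free generator
  imposing one identification.\<close>

lemma regular_epi_p:
  fixes H Q J :: "'u monoid"
  assumes "HQJ H Q J genH evH genQ evQ genJ evJ p j"
  shows "regular_epi AtoMon p"
proof -
  interpret HQJ H Q J genH evH genQ evQ genJ evJ p j by (rule assms)
  obtain F :: "'u monoid" and genF evF where "homogeneous F ({} :: (gen multiset \<times> gen multiset) set) genF evF"
    by (rule ex_homogeneous[OF infinite_univ, of "{}"]) auto
  then interpret F: homogeneous F "{}" genF evF .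
  interpret FH: two_homogeneous F "{}" genF evF H rels_H genH evH ..
  \<comment> \<open>The four generators serve as mere indices: they impose a1 = a2, a2 = a3, c1 = c2
    and c2 = c3.\<close>
  define t where "t x = (case x of Ga \<Rightarrow> Ha1 | Gb \<Rightarrow> Ha2 | Gc \<Rightarrow> Hc1 | Gd \<Rightarrow> Hc2)" for x
  define t' where "t' x = (case x of Ga \<Rightarrow> Ha2 | Gb \<Rightarrow> Ha3 | Gc \<Rightarrow> Hc2 | Gd \<Rightarrow> Hc3)" for x
  obtain f where f: "f \<in> homs AtoMon F H" "\<And>x. arrow_fun f (genF x) = genH (t x)"
    using FH.ex1_arrow[of t] by auto
  obtain g where g: "g \<in> homs AtoMon F H" "\<And>x. arrow_fun g (genF x) = genH (t' x)"
    using FH.ex1_arrow[of t'] by auto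
  have tt: "letter (t x) = letter (t' x)" for x by (cases x) (auto simp: t_def t'_def)
  have gen_closed: "genF x \<in> carrier F" for x using F.ev_closed[of "{#x#}"] by (simp add: F.ev_single)
  have pfg: "Comp AtoMon p f = Comp AtoMon p g"
    by (rule arrow_eq_on_atomsI[OF Comp_homs[OF f(1) p(1)] Comp_homs[OF g(1) p(1)] Q.Units_eq])
      (auto simp: F.atoms_eq arrow_Comp[OF f(1)] arrow_Comp[OF g(1)] f g p(2) tt gen_closed)
  have univ: "\<exists>!k. k \<in> homs AtoMon Q K \<and> Comp AtoMon k p = h"
    if h: "h \<in> homs AtoMon H K" and hfg: "Comp AtoMon h f = Comp AtoMon h g" for h K
  proof -
    have "arrow_fun h (genH (t x)) = arrow_fun h (genH (t' x))" for x
      using Comp_eq_iff[OF f(1) h g(1) h] hfg gen_closed[of x] f(2) g(2) by metis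
    from this[of Ga] this[of Gb] this[of Gc] this[of Gd]
    have hgen: "arrow_fun h (genH Ha2) = arrow_fun h (genH Ha1)"
      "arrow_fun h (genH Ha3) = arrow_fun h (genH Ha1)"
      "arrow_fun h (genH Hc2) = arrow_fun h (genH Hc1)"
      "arrow_fun h (genH Hc3) = arrow_fun h (genH Hc1)"
      by (simp_all add: t_def t'_def)
    \<comment> \<open>\<open>s\<close> picks one generator over each letter, so that
      \<open>\<psi>\<close> takes the values forced on a factorization of \<open>h\<close> through
      \<open>p\<close>.\<close>
    define s where "s x = (case x of Ga \<Rightarrow> Ha1 | Gb \<Rightarrow> Hb | Gc \<Rightarrow> Hc1 | Gd \<Rightarrow> Hd)" for x
    define \<psi> where "\<psi> u = arrow_fun h (evH (image_mset s u))" for u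
    have h_add: "arrow_fun h (evH (u + v)) = arrow_fun h (evH u) \<otimes>\<^bsub>K\<^esub> arrow_fun h (evH v)" for u v
      by (simp add: H.ev_add arrow_mult[OF h] H.ev_closed)
    have h1: "arrow_fun h (evH {#x#}) = arrow_fun h (evH {#s (letter x)#})" for x
      by (cases x) (simp_all add: s_def H.ev_single hgen)
    have h_letter: "arrow_fun h (evH u) = \<psi> (image_mset letter u)" for u
    proof (induction u)
      case (add x u)
      then show ?case
        using h_add[of "{#x#}" u] h_add[of "{#s (letter x)#}" "image_mset s (image_mset letter u)"]
          h1[of x] by (simp add: \<psi>_def)
    qed (simp add: \<psi>_def)
    have rel: "\<psi> u = \<psi> v" if "(u, v) \<in> rels_Q" for u v
    proof -
      \<comment> \<open>The images under \<open>letter\<close> of the two relations of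
        \<open>H\<close> are the two relations of \<open>Q\<close>, so \<open>h_letter\<close>
        transfers them to \<open>\<psi>\<close>.\<close>
      have "evH {#Ha1, Hb#} = evH {#Ha2, Hc1#}" "evH {#Ha3, Hc2#} = evH {#Hc3, Hd#}"
        by (rule H.ev_rel; simp add: rels_H_def)+
      then have "\<psi> {#Ga, Gb#} = \<psi> {#Ga, Gc#}" "\<psi> {#Ga, Gc#} = \<psi> {#Gc, Gd#}"
        using h_letter[of "{#Ha1, Hb#}"] h_letter[of "{#Ha2, Hc1#}"]
          h_letter[of "{#Ha3, Hc2#}"] h_letter[of "{#Hc3, Hd#}"] by simp_all
      with that show ?thesis by (auto simp: rels_Q_def)
    qed
    obtain k where k: "k \<in> homs AtoMon Q K" "\<And>u. arrow_fun k (evQ u) = \<psi> u"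
    proof (rule Q.universal_arrow[of K \<psi>])
      show "atomic_monoid K" by (rule homs_AtoMonD(5)[OF h])
      show "\<psi> u \<in> carrier K" for u by (simp add: \<psi>_def arrow_closed[OF h] H.ev_closed)
      show "\<psi> {#} = \<one>\<^bsub>K\<^esub>" by (simp add: \<psi>_def H.ev_empty homs_AtoMonD(6)[OF h])
      show "\<psi> (u + v) = \<psi> u \<otimes>\<^bsub>K\<^esub> \<psi> v" for u v by (simp add: \<psi>_def h_add)
      show "\<psi> {#x#} \<in> atoms K" for x by (simp add: \<psi>_def H.ev_single H.atoms_eq arrow_atom[OF h])
    qed (use rel in auto)
    show ?thesis
    proof (rule ex1I[of _ k])
      show "k \<in> homs AtoMon Q K \<and> Comp AtoMon k p = h"
        using k Comp_eq_arrow_iff[OF p(1) k(1) h]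
        by (metis H.carrierE p_ev h_letter)
      fix l assume l: "l \<in> homs AtoMon Q K \<and> Comp AtoMon l p = h"
      then have lp: "arrow_fun l (evQ (image_mset letter u)) = arrow_fun h (evH u)" for u
        using Comp_eq_arrow_iff[OF p(1) _ h, of l] H.ev_closed by (simp flip: p_ev)
      \<comment> \<open>Every word over the letters is the image of a word over the generators of
        \<open>H\<close>, so \<open>lp\<close> determines \<open>l\<close> on all of
        \<open>Q\<close>.\<close>
      have sec: "letter (s x) = x" for x by (cases x) (auto simp: s_def)
      have "arrow_fun l (evQ u) = arrow_fun k (evQ u)" for u
        using lp[of "image_mset s u"]
        by (simp add: k(2) h_letter multiset.map_comp comp_def sec)
      with l k show "l = k" by (metis arrow_eqI Q.carrierE)
    qed
  qed
  have "\<exists>!k. k \<in> homs AtoMon Q (snd (snd h)) \<and> Comp AtoMon k p = h"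
    if "h \<in> Arr AtoMon" "fst h = H" "Comp AtoMon h f = Comp AtoMon h g" for h
    using univ[of h "snd (snd h)"] Arr_AtoMon_homs[OF that(1)] that by simp
  then have "is_coequalizer AtoMon f g p"
    unfolding is_coequalizer_def AtoMon_sel
    using homs_AtoMonD[OF f(1)] homs_AtoMonD[OF g(1)] homs_AtoMonD[OF p(1)] pfg
    by simp
  then show ?thesis unfolding regular_epi_def by blast
qed


section \<open>The pullback of p and j\<close>

text \<open>The kernel of the map sending a word to its values in \<open>H\<close> and
  \<open>J\<close>; the generators of \<open>H\<close> suffice since atoms x and y with equal images
  in \<open>Q\<close> satisfy y = \<open>letter\<close> x.\<close>

definition rels_P :: "(gen_H multiset \<times> gen_H multiset) set" where
  "rels_P = {(u, v). comm_cong rels_H u v \<and>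
     comm_cong rels_J (image_mset letter u) (image_mset letter v)}"

text \<open>An intersection of two congruences is itself a congruence, so generating one from it
  adds nothing.\<close>

lemma comm_cong_rels_P: "comm_cong rels_P u v \<longleftrightarrow> (u, v) \<in> rels_P"
proof
  assume "comm_cong rels_P u v"
  then show "(u, v) \<in> rels_P"
    by (induction rule: comm_cong.induct) (auto simp: rels_P_def intro: comm_cong.intros)
qed (rule comm_cong.rel)

section \<open>Joint relations in low degree\<close>

context HQJ
begin

lemma rels_P_iff:
  "(u, v) \<in> rels_P \<longleftrightarrow> evH u = evH v \<and> evJ (image_mset letter u) = evJ (image_mset letter v)"
  by (simp add: rels_P_def H.ev_eq_iff J.ev_eq_iff)

text \<open>Distinct words of length 2 identified in \<open>H\<close> have letters ab and ac, or ac
  and cd, and \<open>J\<close> identifies neither pair.\<close>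

lemma rels_P_short:
  assumes "(u, v) \<in> rels_P"
  shows "size u = size v" "size u < 3 \<Longrightarrow> image_mset letter u = image_mset letter v"
proof -
  have H: "comm_cong rels_H u v" and J: "comm_cong rels_J (image_mset letter u) (image_mset letter v)"
    using assms by (simp_all add: rels_P_def)
  show "size u = size v" by (rule H.comm_cong_size[OF H])
  assume "size u < 3"
  then consider "size u < 2" | "size u = 2" by linarith
  then show "image_mset letter u = image_mset letter v"
  proof cases
    case 1
    then show ?thesis using H.comm_cong_short[OF H] by simp
  next
    case 2
    txt \<open>Normal forms of the words of length 2 in \<open>H\<close> and in \<open>J\<close>.\<close>
    define nH where "nH w = (if w = {#Ha1, Hb#} then {#Ha2, Hc1#}
      else if w = {#Ha3, Hc2#} then {#Hc3, Hd#} else w)" for w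
    define nJ where "nJ w = (if w = {#Ga, Gb#} then {#Gc, Gd#} else w)" for w
    have "nH u = nH v"
      by (rule H.comm_cong_size_2[OF H 2]) (auto simp: rels_H_def nH_def add_eq_conv_ex)
    moreover have "nJ (image_mset letter u) = nJ (image_mset letter v)"
      by (rule J.comm_cong_size_2[OF J]) (auto simp: 2 rels_J_def nJ_def add_eq_conv_ex)
    ultimately show ?thesis
      by (auto simp: nH_def nJ_def add_eq_conv_ex split: if_splits)
  qed
qed

end

section \<open>Universal property of the concrete pullback\<close>

locale HQJP = HQJ H Q J genH evH genQ evQ genJ evJ p j + P: homogeneous P rels_P genP evP
  for H Q J :: "'u monoid" and genH evH genQ evQ genJ evJ p j P genP evP +
  fixes s r
  assumes s: "s \<in> homs AtoMon P H" "\<And>x. arrow_fun s (genP x) = genH x"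
    and r: "r \<in> homs AtoMon P J" "\<And>x. arrow_fun r (genP x) = genJ (letter x)"
begin

sublocale PH: two_homogeneous P rels_P genP evP H rels_H genH evH ..

sublocale PJ: two_homogeneous P rels_P genP evP J rels_J genJ evJ ..

lemma s_ev: "arrow_fun s (evP u) = evH u"
  using PH.arrow_on_ev[of s "\<lambda>x. x"] s by simp

lemma r_ev: "arrow_fun r (evP u) = evJ (image_mset letter u)"
  by (rule PJ.arrow_on_ev) (use r in auto)

lemma evP_eq_iff:
  "evP u = evP v \<longleftrightarrow> evH u = evH v \<and> evJ (image_mset letter u) = evJ (image_mset letter v)"
  by (simp add: P.ev_eq_iff comm_cong_rels_P rels_P_iff)

lemma jointly_injective:
  assumes "z \<in> carrier P" "z' \<in> carrier P"
    and "arrow_fun s z = arrow_fun s z'" "arrow_fun r z = arrow_fun r z'"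
  shows "z = z'"
  using assms by (metis P.carrierE s_ev r_ev evP_eq_iff)

text \<open>An atom of \<open>Z\<close> goes to generators of \<open>H\<close> and \<open>J\<close>
  with the same letter, hence to a generator of \<open>P\<close>; products follow. Preservation of
  atoms is essential: the fibre product of sets also contains the pair (a2 b, ac), which does not
  come from \<open>P\<close>.\<close>

lemma mediating_arrow:
  assumes x: "x \<in> homs AtoMon Z H" and y: "y \<in> homs AtoMon Z J"
    and pj: "\<And>z. z \<in> carrier Z \<Longrightarrow> arrow_fun p (arrow_fun x z) = arrow_fun j (arrow_fun y z)"
  obtains h where "h \<in> homs AtoMon Z P"
    "\<And>z. z \<in> carrier Z \<Longrightarrow> arrow_fun s (arrow_fun h z) = arrow_fun x z"
    "\<And>z. z \<in> carrier Z \<Longrightarrow> arrow_fun r (arrow_fun h z) = arrow_fun y z"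
proof -
  have Z: "atomic_monoid Z" by (rule homs_AtoMonD(4)[OF x])
  interpret Z: monoid Z using Z by (simp add: atomic_monoid_def)
  define lift where
    "lift z u \<longleftrightarrow> arrow_fun x z = evH u \<and> arrow_fun y z = evJ (image_mset letter u)" for z u
  have lift_mult: "lift (z \<otimes>\<^bsub>Z\<^esub> z') (u + v)"
    if "z \<in> carrier Z" "z' \<in> carrier Z" "lift z u" "lift z' v" for z z' u v
    using that by (simp add: lift_def arrow_mult[OF x] arrow_mult[OF y] H.ev_add J.ev_add)
  have lift_atom: "\<exists>a. lift z {#a#}" if z: "z \<in> atoms Z" for z
  proof -
    have zc: "z \<in> carrier Z" using z by (simp add: atoms_def)
    obtain a where a: "arrow_fun x z = genH a" using arrow_atom[OF x z] by (auto simp: H.atoms_eq)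
    obtain b where b: "arrow_fun y z = genJ b" using arrow_atom[OF y z] by (auto simp: J.atoms_eq)
    have "genQ (letter a) = genQ b" using pj[OF zc] by (simp add: a b p(2) j(2))
    then have "b = letter a" using Q.inj_gen by (simp add: inj_eq)
    then show ?thesis by (auto simp: lift_def a b H.ev_single J.ev_single)
  qed
  have lift_unit: "lift z {#}" if "z \<in> Units Z" for z
    using arrow_unit[OF x that] arrow_unit[OF y that]
    by (simp add: lift_def H.Units_eq J.Units_eq H.ev_empty J.ev_empty)
  have ex: "\<exists>u. lift z u" if "z \<in> carrier Z" for z
    using Z that
    by (induction rule: atomic_monoid_induct) (blast intro: lift_unit dest: lift_atom lift_mult)+
  have lift_unique: "evP u = evP v" if "lift z u" "lift z v" for z u v
    using that by (simp add: lift_def evP_eq_iff)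
  \<comment> \<open>Any lifting word will do, since \<open>rels_P\<close> is exactly the joint
    kernel of the values in \<open>H\<close> and \<open>J\<close>.\<close>
  define f where "f z = evP (SOME u. lift z u)" for z
  have f: "f z = evP u" if "lift z u" for z u
    unfolding f_def by (rule lift_unique[OF someI[of "lift z", OF that] that])
  obtain h where h: "h \<in> homs AtoMon Z P" "\<And>z. z \<in> carrier Z \<Longrightarrow> arrow_fun h z = f z"
  proof (rule arrow_exI[OF Z P.atomic_monoid, where f = f])
    show "f z \<in> carrier P" for z by (simp add: f_def P.ev_closed)
    show "f (z \<otimes>\<^bsub>Z\<^esub> z') = f z \<otimes>\<^bsub>P\<^esub> f z'" if z: "z \<in> carrier Z" "z' \<in> carrier Z" for z z'
    proof -
      obtain u v where "lift z u" "lift z' v" using ex z by blast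
      then show ?thesis by (simp add: f[of z u] f[of z' v] f[OF lift_mult[OF z]] P.ev_add)
    qed
    show "f \<one>\<^bsub>Z\<^esub> = \<one>\<^bsub>P\<^esub>" using f[OF lift_unit[OF Z.Units_one_closed]] by (simp add: P.ev_empty)
    show "f z \<in> atoms P" if "z \<in> atoms Z" for z
      using lift_atom[OF that] by (auto simp: f P.ev_single P.atoms_eq)
  qed blast
  show thesis
  proof (rule that[OF h(1)])
    fix z assume z: "z \<in> carrier Z"
    with ex obtain u where "lift z u" by blast
    then show "arrow_fun s (arrow_fun h z) = arrow_fun x z" "arrow_fun r (arrow_fun h z) = arrow_fun y z"
      using z by (simp_all add: h(2) f s_ev r_ev) (simp_all add: lift_def)
  qed
qed

lemma ps_eq_jr: "Comp AtoMon p s = Comp AtoMon j r"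
proof -
  have "arrow_fun p (arrow_fun s z) = arrow_fun j (arrow_fun r z)" if z: "z \<in> carrier P" for z
  proof -
    obtain u where "z = evP u" using z by (rule P.carrierE)
    then show ?thesis by (simp add: s_ev r_ev p_ev j_ev)
  qed
  then show ?thesis using Comp_eq_iff[OF s(1) p(1) r(1) j(1)] by blast
qed

lemma is_pullback: "is_pullback AtoMon p j P s r"
proof -
  have "\<exists>!h. h \<in> homs AtoMon Z P \<and> Comp AtoMon s h = x \<and> Comp AtoMon r h = y"
    if x: "x \<in> homs AtoMon Z H" and y: "y \<in> homs AtoMon Z J"
      and e: "Comp AtoMon p x = Comp AtoMon j y" for Z x y
  proof (rule ex_ex1I)
    have pj: "arrow_fun p (arrow_fun x z) = arrow_fun j (arrow_fun y z)" if "z \<in> carrier Z" for z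
      using Comp_eq_iff[OF x p(1) y j(1)] e that by blast
    show "\<exists>h. h \<in> homs AtoMon Z P \<and> Comp AtoMon s h = x \<and> Comp AtoMon r h = y"
      by (rule mediating_arrow[OF x y pj])
        (use Comp_eq_arrow_iff[OF _ s(1) x] Comp_eq_arrow_iff[OF _ r(1) y] in blast)+
  next
    fix h k
    assume hk: "h \<in> homs AtoMon Z P \<and> Comp AtoMon s h = x \<and> Comp AtoMon r h = y"
      "k \<in> homs AtoMon Z P \<and> Comp AtoMon s k = x \<and> Comp AtoMon r k = y"
    then have h: "h \<in> homs AtoMon Z P" and k: "k \<in> homs AtoMon Z P" by auto
    show "h = k"
    proof (rule arrow_eqI[OF h k])
      fix z assume z: "z \<in> carrier Z"
      show "arrow_fun h z = arrow_fun k z"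
        by (rule jointly_injective) (use z hk arrow_closed[OF h] arrow_closed[OF k] in
          \<open>auto simp flip: arrow_Comp[OF h] arrow_Comp[OF k]\<close>)
    qed
  qed
  then show ?thesis
    unfolding is_pullback_def AtoMon_sel
    using homs_AtoMonD[OF p(1)] homs_AtoMonD[OF j(1)] s(1) r(1) P.atomic_monoid ps_eq_jr by auto
qed

text \<open>An arbitrary pullback is compared with the concrete \<open>P\<close> by
  \<open>\<theta>\<close> and \<open>\<eta>\<close>. If \<open>\<rho>\<close> were a coequalizer,
  the arrow \<open>h'\<close> to a test monoid \<open>K\<close> would factor through it, forcing ab
  = cd in \<open>K\<close>.\<close>

lemma pullback_not_regular_epi:
  assumes pb: "is_pullback AtoMon p j P' \<sigma> \<rho>"
  shows "\<not> regular_epi AtoMon \<rho>"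
proof
  assume "regular_epi AtoMon \<rho>"
  then obtain f g where coeq: "is_coequalizer AtoMon f g \<rho>" by (auto simp: regular_epi_def)
  have dom: "fst p = H" "fst j = J" using p(1) j(1) by (auto simp: homs_AtoMon_iff)
  have \<sigma>: "\<sigma> \<in> homs AtoMon P' H" and \<rho>: "\<rho> \<in> homs AtoMon P' J"
    and comm: "Comp AtoMon p \<sigma> = Comp AtoMon j \<rho>"
    using pb by (simp_all add: is_pullback_def AtoMon_sel dom)
  define F where "F = fst f"
  have f: "f \<in> homs AtoMon F P'" and g: "g \<in> homs AtoMon F P'"
    and \<rho>fg: "Comp AtoMon \<rho> f = Comp AtoMon \<rho> g"
    using coeq homs_AtoMonD[OF \<rho>] by (auto simp: is_coequalizer_def AtoMon_sel F_def homs_def)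
  have "arrow_fun p (arrow_fun \<sigma> z) = arrow_fun j (arrow_fun \<rho> z)" if "z \<in> carrier P'" for z
    using Comp_eq_iff[OF \<sigma> p(1) \<rho> j(1)] comm that by blast
  then obtain \<theta> where \<theta>: "\<theta> \<in> homs AtoMon P' P"
    "\<And>z. z \<in> carrier P' \<Longrightarrow> arrow_fun s (arrow_fun \<theta> z) = arrow_fun \<sigma> z"
    "\<And>z. z \<in> carrier P' \<Longrightarrow> arrow_fun r (arrow_fun \<theta> z) = arrow_fun \<rho> z"
    by (rule mediating_arrow[OF \<sigma> \<rho>]) auto
  have "\<exists>!h. h \<in> homs AtoMon Z P' \<and> Comp AtoMon \<sigma> h = x \<and> Comp AtoMon \<rho> h = y"
    if "Z \<in> Ob AtoMon" "x \<in> homs AtoMon Z H" "y \<in> homs AtoMon Z J"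
      "Comp AtoMon p x = Comp AtoMon j y" for Z x y
    using pb that by (simp add: is_pullback_def AtoMon_sel(2) dom)
  \<comment> \<open>The universal property of the given pullback, applied to the cone with vertex
    \<open>P\<close>.\<close>
  from this[OF _ s(1) r(1) ps_eq_jr]
  have "\<exists>\<eta>. \<eta> \<in> homs AtoMon P P' \<and> Comp AtoMon \<sigma> \<eta> = s \<and> Comp AtoMon \<rho> \<eta> = r"
    by (rule ex1_implies_ex) (simp add: AtoMon_sel(1) P.atomic_monoid)
  then obtain \<eta> where \<eta>: "\<eta> \<in> homs AtoMon P P'"
    "\<And>z. z \<in> carrier P \<Longrightarrow> arrow_fun \<sigma> (arrow_fun \<eta> z) = arrow_fun s z"
    "\<And>z. z \<in> carrier P \<Longrightarrow> arrow_fun \<rho> (arrow_fun \<eta> z) = arrow_fun r z"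
    using arrow_Comp by metis
  have \<theta>\<eta>: "arrow_fun \<theta> (arrow_fun \<eta> z) = z" if "z \<in> carrier P" for z
    by (rule jointly_injective) (simp_all add: that \<theta> \<eta> arrow_closed[OF \<theta>(1)] arrow_closed[OF \<eta>(1)])

  \<comment> \<open>The threshold 3 is the point: relations of \<open>P\<close> that change letters
    start in degree 3 and are absorbed here, while ab and cd stay distinct in degree 2.\<close>
  define rels_K :: "(gen multiset \<times> gen multiset) set" where
    "rels_K = {(u, v). size u = size v \<and> 3 \<le> size u}"
  obtain K :: "'u monoid" and genK evK where "homogeneous K rels_K genK evK"
    by (rule ex_homogeneous[OF infinite_univ, of rels_K]) (auto simp: rels_K_def)
  then interpret K: homogeneous K rels_K genK evK .
  interpret PK: two_homogeneous P rels_P genP evP K rels_K genK evK ..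
  have "evK (image_mset letter u) = evK (image_mset letter v)" if "(u, v) \<in> rels_P" for u v
    using rels_P_short[OF that]
    by (cases "size u < 3") (auto intro: K.ev_rel simp: rels_K_def)
  then obtain h where h: "h \<in> homs AtoMon P K" "\<And>x. arrow_fun h (genP x) = genK (letter x)"
    using PK.ex1_arrow[of letter] by blast
  define h' where "h' = Comp AtoMon h \<theta>"
  have h': "h' \<in> homs AtoMon P' K" unfolding h'_def by (rule Comp_homs[OF \<theta>(1) h(1)])
  \<comment> \<open>The parallel arrows followed by \<open>\<theta>\<close> send an atom to
    generators of \<open>P\<close>. These have the same letter because \<open>\<rho>\<close>
    equalizes the pair and generators of \<open>J\<close> are distinct, and \<open>h\<close> sees
    only the letter.\<close>
  have "Comp AtoMon h' f = Comp AtoMon h' g"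
  proof (rule arrow_eq_on_atomsI[OF Comp_homs[OF f h'] Comp_homs[OF g h'] K.Units_eq])
    fix z assume z: "z \<in> atoms F"
    then have zc: "z \<in> carrier F" by (simp add: atoms_def)
    obtain a where a: "arrow_fun \<theta> (arrow_fun f z) = genP a"
      using arrow_atom[OF \<theta>(1) arrow_atom[OF f z]] by (auto simp: P.atoms_eq)
    obtain b where b: "arrow_fun \<theta> (arrow_fun g z) = genP b"
      using arrow_atom[OF \<theta>(1) arrow_atom[OF g z]] by (auto simp: P.atoms_eq)
    have "arrow_fun \<rho> (arrow_fun f z) = arrow_fun \<rho> (arrow_fun g z)"
      using Comp_eq_iff[OF f \<rho> g \<rho>] \<rho>fg zc by blast
    then have "genJ (letter a) = genJ (letter b)"
      using \<theta>(3)[OF arrow_closed[OF f zc]] \<theta>(3)[OF arrow_closed[OF g zc]] by (simp add: a b r(2))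
    then have "letter a = letter b" using J.inj_gen by (simp add: inj_eq)
    then show "arrow_fun (Comp AtoMon h' f) z = arrow_fun (Comp AtoMon h' g) z"
      using arrow_closed[OF f zc] arrow_closed[OF g zc] zc
      by (simp add: arrow_Comp[OF f] arrow_Comp[OF g] h'_def arrow_Comp[OF \<theta>(1)] a b h(2))
  qed
  moreover have "\<exists>!k. k \<in> homs AtoMon (snd (snd \<rho>)) (snd (snd h')) \<and> Comp AtoMon k \<rho> = h'"
    if "h' \<in> Arr AtoMon" "fst h' = snd (snd f)" "Comp AtoMon h' f = Comp AtoMon h' g" for h'
    using coeq that by (simp add: is_coequalizer_def AtoMon_sel)
  ultimately have "\<exists>!k. k \<in> homs AtoMon J K \<and> Comp AtoMon k \<rho> = h'"
    using homs_AtoMonD(3)[OF f] homs_AtoMonD(3)[OF \<rho>] homs_AtoMonD(1,2,3)[OF h'] by metis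
  then obtain k where k: "k \<in> homs AtoMon J K" "Comp AtoMon k \<rho> = h'" by blast
  \<comment> \<open>Precomposing with \<open>\<eta>\<close> turns the factorization of
    \<open>h'\<close> through \<open>\<rho>\<close> into one of \<open>h\<close> through
    \<open>r\<close>.\<close>
  have kr: "arrow_fun k (arrow_fun r z) = arrow_fun h z" if "z \<in> carrier P" for z
  proof -
    have "arrow_fun k (arrow_fun \<rho> (arrow_fun \<eta> z)) = arrow_fun h (arrow_fun \<theta> (arrow_fun \<eta> z))"
      using Comp_eq_arrow_iff[OF \<rho> k(1) h'] k(2) arrow_closed[OF \<eta>(1) that]
      by (simp add: h'_def arrow_Comp[OF \<theta>(1)])
    then show ?thesis by (simp add: \<theta>\<eta> \<eta> that)
  qed
  interpret JK: two_homogeneous J rels_J genJ evJ K rels_K genK evK ..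
  have k_letter: "arrow_fun k (genJ (letter x)) = genK (letter x)" for x
    using kr[of "genP x"] P.ev_closed[of "{#x#}"] by (simp add: P.ev_single r(2) h(2))
  \<comment> \<open>Each of the four letters lies under some generator of \<open>H\<close>, so
    \<open>k\<close> is known on all generators of \<open>J\<close>.\<close>
  have "arrow_fun k (genJ x) = genK x" for x
    using k_letter[of Ha1] k_letter[of Hb] k_letter[of Hc1] k_letter[of Hd] by (cases x) simp_all
  then have k_ev: "arrow_fun k (evJ u) = evK u" for u
    using JK.arrow_on_ev[of k "\<lambda>x. x"] k(1) by simp
  \<comment> \<open>An invariant of \<open>rels_K\<close> that separates words of length 2: related
    words have length at least 3, so both get the default value \<open>{#}\<close>.\<close>
  define nK :: "gen multiset \<Rightarrow> gen multiset" where "nK w = (if size w = 2 then w else {#})" for w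
  have "evJ {#Ga, Gb#} = evJ {#Gc, Gd#}" by (rule J.ev_rel) (simp add: rels_J_def)
  then have "evK {#Ga, Gb#} = evK {#Gc, Gd#}" by (metis k_ev)
  then have "comm_cong rels_K {#Ga, Gb#} {#Gc, Gd#}" by (simp add: K.ev_eq_iff)
  then have "nK {#Ga, Gb#} = nK {#Gc, Gd#}"
    by (rule K.comm_cong_size_2) (auto simp: rels_K_def nK_def)
  then show False by (simp add: nK_def add_eq_conv_ex)
qed

end

section \<open>Existence of the concrete pullback and conclusion\<close>

lemma (in HQJ) ex_HQJP:
  obtains P genP evP s r where "HQJP H Q J genH evH genQ evQ genJ evJ p j P genP evP s r"
proof -
  \<comment> \<open>\<open>rels_P\<close> is contained in the congruence of \<open>H\<close>, which
    preserves length and is equality below length 2.\<close>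
  have "size u = size v \<and> (u = v \<or> 2 \<le> size u)" if "(u, v) \<in> rels_P" for u v
    using that H.comm_cong_size[of u v] H.comm_cong_short[of u v] by (auto simp: rels_P_def)
  then obtain P :: "'u monoid" and genP evP where "homogeneous P rels_P genP evP"
    by (rule ex_homogeneous[OF infinite_univ]) auto
  then interpret P: homogeneous P rels_P genP evP .
  interpret PH: two_homogeneous P rels_P genP evP H rels_H genH evH ..
  interpret PJ: two_homogeneous P rels_P genP evP J rels_J genJ evJ ..
  obtain s where s: "s \<in> homs AtoMon P H" "\<And>x. arrow_fun s (genP x) = genH x"
    using PH.ex1_arrow[of "\<lambda>x. x"] by (auto simp: rels_P_iff)
  obtain r where r: "r \<in> homs AtoMon P J" "\<And>x. arrow_fun r (genP x) = genJ (letter x)"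
    using PJ.ex1_arrow[of letter] by (auto simp: rels_P_iff)
  show thesis
    by (rule that, unfold_locales) (use s r in auto)
qed

theorem proposition3p7:
  fixes H Q J :: "'u monoid"
    and genH :: "gen_H \<Rightarrow> 'u" and genQ genJ :: "gen \<Rightarrow> 'u"
  assumes "infinite (UNIV :: 'u set)"
    and "presented_by H rels_H genH"
    and "presented_by Q rels_Q genQ"
    and "presented_by J rels_J genJ"
  shows "H \<in> Ob AtoMon \<and> bij_betw genH UNIV (atoms H)
    \<and> Q \<in> Ob AtoMon \<and> bij_betw genQ UNIV (atoms Q)
    \<and> J \<in> Ob AtoMon \<and> bij_betw genJ UNIV (atoms J)
    \<and> (\<exists>!p. p \<in> homs AtoMon H Q \<and> (\<forall>x. arrow_fun p (genH x) = genQ (letter x)))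
    \<and> (\<exists>!j. j \<in> homs AtoMon J Q \<and> (\<forall>x. arrow_fun j (genJ x) = genQ x))
    \<and> (\<forall>p j. p \<in> homs AtoMon H Q \<and> (\<forall>x. arrow_fun p (genH x) = genQ (letter x))
           \<and> j \<in> homs AtoMon J Q \<and> (\<forall>x. arrow_fun j (genJ x) = genQ x) \<longrightarrow>
         (\<exists>P \<sigma> \<rho>. is_pullback AtoMon p j P \<sigma> \<rho>)
         \<and> (\<forall>P \<sigma> \<rho>. is_pullback AtoMon p j P \<sigma> \<rho> \<longrightarrow> \<not> regular_epi AtoMon \<rho>))
    \<and> \<not> regular_category (AtoMon :: ('u monoid, 'u arrow) cat)"
proof -
  obtain evH where "presentation H rels_H genH evH" using assms(2) by (rule presented_by_presentation)
  then interpret H: homogeneous H rels_H genH evH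
    by (intro homogeneous.intro homogeneous_axioms.intro) (auto simp: rels_H_def)
  obtain evQ where "presentation Q rels_Q genQ evQ" using assms(3) by (rule presented_by_presentation)
  then interpret Q: homogeneous Q rels_Q genQ evQ
    by (intro homogeneous.intro homogeneous_axioms.intro) (auto simp: rels_Q_def)
  obtain evJ where "presentation J rels_J genJ evJ" using assms(4) by (rule presented_by_presentation)
  then interpret J: homogeneous J rels_J genJ evJ
    by (intro homogeneous.intro homogeneous_axioms.intro) (auto simp: rels_J_def)
  interpret HQ: two_homogeneous H rels_H genH evH Q rels_Q genQ evQ ..
  interpret JQ: two_homogeneous J rels_J genJ evJ Q rels_Q genQ evQ ..
  \<comment> \<open>Chained together these give ab = cd, so the relations of \<open>H\<close> and of
    \<open>J\<close> both hold in \<open>Q\<close>.\<close>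
  have Qrel: "evQ {#Ga, Gb#} = evQ {#Ga, Gc#}" "evQ {#Ga, Gc#} = evQ {#Gc, Gd#}"
    by (rule Q.ev_rel; simp add: rels_Q_def)+
  have ex1_p: "\<exists>!p. p \<in> homs AtoMon H Q \<and> (\<forall>x. arrow_fun p (genH x) = genQ (letter x))"
    by (rule HQ.ex1_arrow) (auto simp: rels_H_def Qrel)
  have ex1_j: "\<exists>!j. j \<in> homs AtoMon J Q \<and> (\<forall>x. arrow_fun j (genJ x) = genQ x)"
    by (rule JQ.ex1_arrow) (auto simp: rels_J_def Qrel)
  have main: "regular_epi AtoMon p \<and> (\<exists>P \<sigma> \<rho>. is_pullback AtoMon p j P \<sigma> \<rho>)
      \<and> (\<forall>P \<sigma> \<rho>. is_pullback AtoMon p j P \<sigma> \<rho> \<longrightarrow> \<not> regular_epi AtoMon \<rho>)"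
    if "p \<in> homs AtoMon H Q" "\<forall>x. arrow_fun p (genH x) = genQ (letter x)"
      "j \<in> homs AtoMon J Q" "\<forall>x. arrow_fun j (genJ x) = genQ x" for p j
  proof -
    interpret HQJ H Q J genH evH genQ evQ genJ evJ p j
      by unfold_locales (use that assms(1) in auto)
    obtain P genP evP s r where "HQJP H Q J genH evH genQ evQ genJ evJ p j P genP evP s r"
      by (rule ex_HQJP)
    then interpret HQJP H Q J genH evH genQ evQ genJ evJ p j P genP evP s r .
    show ?thesis
      using regular_epi_p[OF HQJ_axioms] is_pullback pullback_not_regular_epi by blast
  qed
  \<comment> \<open>\<open>p\<close> is a regular epimorphism with a pullback along \<open>j\<close>
    whose projection to \<open>J\<close> is not one, against the stability clause.\<close>
  have "\<not> regular_category (AtoMon :: ('u monoid, 'u arrow) cat)"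
    using ex1_p ex1_j main unfolding regular_category_def by metis
  then show ?thesis
    using ex1_p ex1_j main H.atomic_monoid Q.atomic_monoid J.atomic_monoid
      H.bij_betw_gen Q.bij_betw_gen J.bij_betw_gen
    by (auto simp: AtoMon_sel)
qed

end
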